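(* Assume that $$\frac{(z;\boldsymbol\alpha)^{n+1}\,(w|\boldsymbol\beta)^{n+1}}{(z|\boldsymbol\beta)^{n+1}\,(w;\boldsymbol\alpha)^{n+1}}\xrightarrow{\,n\to\infty\,}0,\qquad\text{resp.}\qquad\frac{(z|\boldsymbol\beta)^{n+1}\,(w;\boldsymbol\alpha)^{n+1}}{(z;\boldsymbol\alpha)^{n+1}\,(w|\boldsymbol\beta)^{n+1}}\xrightarrow{\,n\to\infty\,}0.$$ Then $$\langle\varnothing|\,\psi(z|\boldsymbol\alpha;\boldsymbol\beta)\,\psi^*(w|\boldsymbol\alpha;\boldsymbol\beta)\,|\varnothing\rangle=\frac{z}{z-w},\qquad\text{resp.}\qquad\langle\varnothing|\,\psi^*(w|\boldsymbol\alpha;\boldsymbol\beta)\,\psi(z|\boldsymbol\alpha;\boldsymbol\beta)\,|\varnothing\rangle=\frac{z}{w-z},$$ as functions $\mathbb C^2\to\mathbb C$ (the first identity under the first assumption, the second identity under the second assumption).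
   Context: $\boldsymbol\alpha=(\alpha_i)_{i\in\mathbb Z}$ and $\boldsymbol\beta=(\beta_i)_{i\in\mathbb Z}$ are sequences of complex numbers. Shifted powers: for $k\in\mathbb Z$, $(z;\boldsymbol\alpha)^k=\prod_{i=1}^k(1-z\alpha_i)$ if $k\ge 0$ and $(z;\boldsymbol\alpha)^k=\prod_{i=k+1}^{0}(1-z\alpha_i)^{-1}$ if $k<0$; $(z|\boldsymbol\beta)^k=\prod_{i=1}^k(z-\beta_i)$ if $k\ge0$ and $(z|\boldsymbol\beta)^k=\prod_{i=k+1}^0(z-\beta_i)^{-1}$ if $k<0$. The Clifford algebra is generated by $\psi_i,\psi_i^*$ ($i\in\mathbb Z$) with $\psi_i\psi_j+\psi_j\psi_i=0=\psi_i^*\psi_j^*+\psi_j^*\psi_i^*$ and $\psi_i\psi_j^*+\psi_j^*\psi_i=\delta_{ij}$. The fermionic Fock space is its irreducible module generated by the vacuum $|\varnothing\rangle$ with $\psi_i|\varnothing\rangle=0$ for $i\le 0$ and $\psi_j^*|\varnothing\rangle=0$ for $j>0$; the dual vacuum $\langle\varnothing|$ satisfies $\langle\varnothing|\psi_i=0$ for $i>0$, $\langle\varnothing|\psi_j^*=0$ for $j\le0$, $\langle\varnothing|\varnothing\rangle=1$. Hence $\langle\varnothing|\psi_i\psi_j^*|\varnothing\rangle=\delta_{ij}$ if $i,j\le 0$ and $0$ otherwise, and $\langle\varnothing|\psi_j^*\psi_i|\varnothing\rangle=\delta_{ij}$ if $i,j>0$ and $0$ otherwise. Deformed fermion fields: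 $\psi(z|\boldsymbol\alpha;\boldsymbol\beta)=\sum_{i\in\mathbb Z} z\frac{(z|\boldsymbol\beta)^{i-1}}{(z;\boldsymbol\alpha)^i}\psi_i$, $\ \psi^*(w|\boldsymbol\alpha;\boldsymbol\beta)=\sum_{j\in\mathbb Z}(1-\alpha_j\beta_j)\frac{(w;\boldsymbol\alpha)^{j-1}}{(w|\boldsymbol\beta)^j}\psi_j^*$. The vacuum expectation of a product of two fields is the series obtained by bilinear expansion.
   Formalization: The first assumption is false as printed (series can diverge); it is corrected to the same ratio of factors taken over indices -n,…,0 instead of 1,…,n+1. Identities hold pointwise away from poles of the contributing terms, with the double series summed over growing rectangles. *)

theory Defs
  imports "HOL-Analysis.Analysis"
begin

definition shifted_power_alpha :: "complex \<Rightarrow> (int \<Rightarrow> complex) \<Rightarrow> int \<Rightarrow> complex"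
  where "shifted_power_alpha z \<alpha> k =
    (if 0 \<le> k then \<Prod>i\<in>{1..k}. (1 - z * \<alpha> i)
     else \<Prod>i\<in>{k+1..0}. inverse (1 - z * \<alpha> i))"

definition shifted_power_beta :: "complex \<Rightarrow> (int \<Rightarrow> complex) \<Rightarrow> int \<Rightarrow> complex"
  where "shifted_power_beta z \<beta> k =
    (if 0 \<le> k then \<Prod>i\<in>{1..k}. (z - \<beta> i)
     else \<Prod>i\<in>{k+1..0}. inverse (z - \<beta> i))"

text \<open>
  A module over the Clifford algebra is a complex vector space with linear operators
  \<open>psi i\<close>, \<open>psis i\<close> that satisfy the defining relations of the algebra; \<open>psis\<close> is the starred
  family. The right action on a functional is precomposition, so \<open>\<langle>\<emptyset>|\<psi>\<^sub>i = 0\<close> reads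
  \<open>covac (psi i v) = 0\<close> for all \<open>v\<close>. That the vacuum is nonzero and generates the module
  follows from \<open>covac_vac\<close> and irreducibility.
\<close>

locale fermionic_fock_space = vector_space scale
  for scale :: "complex \<Rightarrow> 'v::ab_group_add \<Rightarrow> 'v" +
  fixes psi psis :: "int \<Rightarrow> 'v \<Rightarrow> 'v"
    and vac :: 'v
    and covac :: "'v \<Rightarrow> complex"
  assumes linear_psi: "Vector_Spaces.linear scale scale (psi i)"
    and linear_psis: "Vector_Spaces.linear scale scale (psis i)"
    and linear_covac: "Vector_Spaces.linear scale (*) covac"
    and psi_psi: "psi i (psi j v) + psi j (psi i v) = 0"
    and psis_psis: "psis i (psis j v) + psis j (psis i v) = 0"
    and psi_psis: "psi i (psis j v) + psis j (psi i v) = (if i = j then v else 0)"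
    and irreducible: "subspace S \<Longrightarrow> (\<And>i. psi i ` S \<subseteq> S) \<Longrightarrow> (\<And>i. psis i ` S \<subseteq> S)
      \<Longrightarrow> S = {0} \<or> S = UNIV"
    and psi_vac: "i \<le> 0 \<Longrightarrow> psi i vac = 0"
    and psis_vac: "0 < i \<Longrightarrow> psis i vac = 0"
    and covac_psi: "0 < i \<Longrightarrow> covac (psi i v) = 0"
    and covac_psis: "i \<le> 0 \<Longrightarrow> covac (psis i v) = 0"
    and covac_vac: "covac vac = 1"

text \<open>
  The deformed fields are formal series in the generators; they are represented by the
  families of their coefficients.
\<close>

definition field_coeff :: "(int \<Rightarrow> complex) \<Rightarrow> (int \<Rightarrow> complex) \<Rightarrow> complex \<Rightarrow> int \<Rightarrow> complex"
  where "field_coeff \<alpha> \<beta> z i =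
    z * (shifted_power_beta z \<beta> (i - 1) / shifted_power_alpha z \<alpha> i)"

definition dual_field_coeff :: "(int \<Rightarrow> complex) \<Rightarrow> (int \<Rightarrow> complex) \<Rightarrow> complex \<Rightarrow> int \<Rightarrow> complex"
  where "dual_field_coeff \<alpha> \<beta> w j =
    (1 - \<alpha> j * \<beta> j) * (shifted_power_alpha w \<alpha> (j - 1) / shifted_power_beta w \<beta> j)"

text \<open>
  Convergence of a double series over all pairs of integers: the sums over rectangles
  converge when the four bounds tend to infinity independently of each other. Unconditional
  summability would be too strong here, as the expansions below may converge only
  conditionally.
\<close>

definition double_series_sums :: "(int \<Rightarrow> int \<Rightarrow> complex) \<Rightarrow> complex \<Rightarrow> bool"
  where "double_series_sums f s \<longleftrightarrow>
    ((\<lambda>((a, b), (c, d)). \<Sum>i\<in>{a..b}. \<Sum>j\<in>{c..d}. f i j) \<longlongrightarrow> s)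
      ((at_bot \<times>\<^sub>F at_top) \<times>\<^sub>F (at_bot \<times>\<^sub>F at_top))"

text \<open>
  The series obtained from \<open>\<langle>\<emptyset>| (\<Sum>i. a i A i) (\<Sum>j. b j B j) |\<emptyset>\<rangle>\<close> by bilinear
  expansion converges to \<open>s\<close>.
\<close>

definition vacuum_expectation_sums ::
    "('v \<Rightarrow> complex) \<Rightarrow> 'v \<Rightarrow> (int \<Rightarrow> complex) \<Rightarrow> (int \<Rightarrow> 'v \<Rightarrow> 'v)
      \<Rightarrow> (int \<Rightarrow> complex) \<Rightarrow> (int \<Rightarrow> 'v \<Rightarrow> 'v) \<Rightarrow> complex \<Rightarrow> bool"
  where "vacuum_expectation_sums covac vac a A b B s \<longleftrightarrow>
    double_series_sums (\<lambda>i j. a i * b j * covac (A i (B j vac))) s"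

text \<open>
  For \<open>n \<ge> 0\<close> and \<open>k = - (n + 1)\<close> this ratio is the product over \<open>-n \<le> i \<le> 0\<close> of
  \<open>(1 - z \<alpha>\<^sub>i) (w - \<beta>\<^sub>i) / ((z - \<beta>\<^sub>i) (1 - w \<alpha>\<^sub>i))\<close>; for \<open>k = n + 1\<close> it is the product over
  \<open>1 \<le> i \<le> n + 1\<close> of the reciprocals. The expectation of \<open>\<psi> \<psi>\<^sup>*\<close> involves only the indices
  \<open>i \<le> 0\<close>, so its convergence is governed by the negative powers, and that of \<open>\<psi>\<^sup>* \<psi>\<close> by the
  positive ones.
\<close>

definition shifted_power_ratio ::
    "(int \<Rightarrow> complex) \<Rightarrow> (int \<Rightarrow> complex) \<Rightarrow> complex \<Rightarrow> complex \<Rightarrow> int \<Rightarrow> complex"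
  where "shifted_power_ratio \<alpha> \<beta> z w k =
    (shifted_power_beta z \<beta> k * shifted_power_alpha w \<alpha> k)
      / (shifted_power_alpha z \<alpha> k * shifted_power_beta w \<beta> k)"

end

theory Submission
  imports Defs
begin

text \<open>
  By the anticommutation relations only the diagonal pairs \<open>i = j\<close> contribute to the vacuum
  expectation of a product of two fields, and only on one side of the vacuum: \<open>i \<le> 0\<close> for
  \<open>\<psi> \<psi>\<^sup>*\<close>, \<open>i > 0\<close> for \<open>\<psi>\<^sup>* \<psi>\<close>. Up to the factor \<open>z (1 - \<alpha>\<^sub>i \<beta>\<^sub>i)\<close>, the surviving term is
  the ratio \<open>R\<^sub>k\<close> of shifted powers (\<open>k = i\<close> for \<open>i \<le> 0\<close>, \<open>k = i - 1\<close> for \<open>i > 0\<close>)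
  divided by two linear factors. The identity
  \<open>(z - \<beta>) (1 - w \<alpha>) - (1 - z \<alpha>) (w - \<beta>) = (z - w) (1 - \<alpha> \<beta>)\<close> turns \<open>z - w\<close> times that term
  into \<open>z (R\<^sub>i - R\<^sub>i\<^sub>-\<^sub>1)\<close>, so the series telescopes; its value is fixed by \<open>R\<^sub>0 = 1\<close> and the
  assumed limit \<open>0\<close> at the other end.

  The case \<open>z = w\<close> cannot occur: there all linear factors cancel, so on the half line
  that contributes the ratio is constantly \<open>1\<close> and does not tend to \<open>0\<close>.

  Both expectations become instances of one statement about telescoping diagonal double series
  (\<open>double_series_sums_telescoping\<close>) once the ratio is frozen at its value \<open>1\<close> on the half line
  that does not contribute, i.e. \<open>R\<^bsub>min i 0\<^esub>\<close> respectively \<open>R\<^bsub>max i 0\<^esub>\<close>.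
\<close>

section \<open>Telescoping double series\<close>

lemma sum_rectangle_diagonal:
  fixes g :: "int \<Rightarrow> 'a::comm_monoid_add"
  shows "(\<Sum>i\<in>{a..b}. \<Sum>j\<in>{c..d}. if i = j then g i else 0) = sum g {max a c..min b d}"
proof -
  have "(\<Sum>i\<in>{a..b}. \<Sum>j\<in>{c..d}. if i = j then g i else 0)
      = (\<Sum>i\<in>{a..b}. if i \<in> {c..d} then g i else 0)"
    by (rule sum.cong) auto
  also have "\<dots> = sum g ({a..b} \<inter> {c..d})"
    by (rule sum.inter_restrict [symmetric]) simp
  also have "{a..b} \<inter> {c..d} = {max a c..min b d}"
    by auto
  finally show ?thesis .
qed

lemma sum_telescoping_int:
  fixes F :: "int \<Rightarrow> 'a::ab_group_add"
  assumes "a \<le> b + 1"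
  shows "(\<Sum>i\<in>{a..b}. F i - F (i - 1)) = F b - F (a - 1)"
proof -
  have "a - 1 \<le> b"
    using assms by simp
  then show ?thesis
  proof (induction b rule: int_ge_induct)
    case base
    then show ?case by simp
  next
    case (step i)
    then have "{a..i + 1} = insert (i + 1) {a..i}"
      by auto
    with step.IH show ?case by simp
  qed
qed

text \<open>
  A rectangle meets the diagonal in the interval \<open>{max a c..min b d}\<close>, whose ends tend to
  \<open>-\<infinity>\<close> and \<open>\<infinity>\<close> however the four bounds move.
\<close>

lemma double_series_sums_telescoping:
  assumes diag: "\<And>i j. f i j = (if i = j then F i - F (i - 1) else 0)"
    and top: "(F \<longlongrightarrow> L) at_top"
    and bot: "(F \<longlongrightarrow> l) at_bot"
  shows "double_series_sums f (L - l)"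
proof -
  let ?H = "(at_bot \<times>\<^sub>F at_top) \<times>\<^sub>F (at_bot \<times>\<^sub>F at_top) :: ((int \<times> int) \<times> (int \<times> int)) filter"
  have a: "filterlim (\<lambda>p. fst (fst p)) at_bot ?H" and b: "filterlim (\<lambda>p. snd (fst p)) at_top ?H"
    and c: "filterlim (\<lambda>p. fst (snd p)) at_bot ?H" and d: "filterlim (\<lambda>p. snd (snd p)) at_top ?H"
    by (rule filterlim_compose [OF filterlim_fst filterlim_fst]
        filterlim_compose [OF filterlim_snd filterlim_fst]
        filterlim_compose [OF filterlim_fst filterlim_snd]
        filterlim_compose [OF filterlim_snd filterlim_snd])+
  let ?lo = "\<lambda>p::(int \<times> int) \<times> (int \<times> int). max (fst (fst p)) (fst (snd p))"
  let ?hi = "\<lambda>p::(int \<times> int) \<times> (int \<times> int). min (snd (fst p)) (snd (snd p))"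
  have low: "\<forall>\<^sub>F p in ?H. ?lo p \<le> k" for k
    using a c by (simp add: filterlim_at_bot eventually_conj_iff)
  have high: "\<forall>\<^sub>F p in ?H. k \<le> ?hi p" for k
    using b d by (simp add: filterlim_at_top eventually_conj_iff)
  have "filterlim (\<lambda>p. ?lo p - 1) at_bot ?H"
    unfolding filterlim_at_bot
  proof
    fix k
    show "\<forall>\<^sub>F p in ?H. ?lo p - 1 \<le> k"
      using low [of "k + 1"] by eventually_elim linarith
  qed
  moreover have "filterlim ?hi at_top ?H"
    unfolding filterlim_at_top using high by blast
  ultimately have "((\<lambda>p. F (?hi p) - F (?lo p - 1)) \<longlongrightarrow> L - l) ?H"
    using filterlim_compose [OF top] filterlim_compose [OF bot] by (intro tendsto_diff)
  moreover have "\<forall>\<^sub>F p in ?H. F (?hi p) - F (?lo p - 1)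
      = (\<lambda>((a, b), (c, d)). \<Sum>i\<in>{a..b}. \<Sum>j\<in>{c..d}. f i j) p"
    \<comment> \<open>The sum telescopes only once the rectangle meets the diagonal, e.g. in \<open>(0, 0)\<close>.\<close>
    using low [of 0] high [of 0]
  proof eventually_elim
    case (elim p)
    obtain a b c d where p: "p = ((a, b), (c, d))"
      by (metis prod.collapse)
    have "(\<Sum>i\<in>{a..b}. \<Sum>j\<in>{c..d}. f i j) = (\<Sum>i\<in>{max a c..min b d}. F i - F (i - 1))"
      unfolding diag by (rule sum_rectangle_diagonal)
    also have "\<dots> = F (min b d) - F (max a c - 1)"
      using elim by (intro sum_telescoping_int) (auto simp: p min_def max_def)
    finally show ?case
      by (simp add: p)
  qed
  ultimately show ?thesis
    unfolding double_series_sums_def by (rule Lim_transform_eventually)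
qed

lemma tendsto_int_at_top_from_nat:
  assumes "(\<lambda>n::nat. f (int n + 1)) \<longlonglongrightarrow> L"
  shows "(f \<longlongrightarrow> L) at_top"
proof (rule Lim_transform_eventually)
  have "filterlim (\<lambda>k::int. nat (k - 1)) at_top at_top"
    unfolding filterlim_at_top
  proof
    fix n :: nat
    show "\<forall>\<^sub>F k::int in at_top. n \<le> nat (k - 1)"
      using eventually_ge_at_top [of "int n + 1"] by eventually_elim simp
  qed
  then show "((\<lambda>k. f (int (nat (k - 1)) + 1)) \<longlongrightarrow> L) at_top"
    by (rule filterlim_compose [OF assms])
  show "\<forall>\<^sub>F k in at_top. f (int (nat (k - 1)) + 1) = f k"
    using eventually_ge_at_top [of 1] by eventually_elim simp
qed

lemma tendsto_int_at_bot_from_nat: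
  assumes "(\<lambda>n::nat. f (- (int n + 1))) \<longlonglongrightarrow> L"
  shows "(f \<longlongrightarrow> L) at_bot"
proof -
  have "((\<lambda>k. f (- k)) \<longlongrightarrow> L) at_top"
    using assms by (rule tendsto_int_at_top_from_nat)
  moreover have "filterlim (uminus :: int \<Rightarrow> int) at_top at_bot"
    unfolding filterlim_at_top
  proof
    fix k :: int
    show "\<forall>\<^sub>F x in at_bot. k \<le> - x"
      using eventually_le_at_bot [of "- k"] by eventually_elim simp
  qed
  ultimately have "((\<lambda>k. f (- (- k))) \<longlongrightarrow> L) at_bot"
    by (rule filterlim_compose)
  then show ?thesis by simp
qed

section \<open>Shifted powers and their ratio\<close>

lemma shifted_power_alpha_step_pos:
  "0 < k \<Longrightarrow> shifted_power_alpha z \<alpha> k = shifted_power_alpha z \<alpha> (k - 1) * (1 - z * \<alpha> k)"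
proof -
  assume "0 < k"
  moreover from this have "{1..k} = insert k {1..k - 1}" by auto
  ultimately show ?thesis by (simp add: shifted_power_alpha_def)
qed

lemma shifted_power_beta_step_pos:
  "0 < k \<Longrightarrow> shifted_power_beta z \<beta> k = shifted_power_beta z \<beta> (k - 1) * (z - \<beta> k)"
proof -
  assume "0 < k"
  moreover from this have "{1..k} = insert k {1..k - 1}" by auto
  ultimately show ?thesis by (simp add: shifted_power_beta_def)
qed

lemma shifted_power_alpha_step_nonpos:
  "k \<le> 0 \<Longrightarrow> shifted_power_alpha z \<alpha> (k - 1) = shifted_power_alpha z \<alpha> k / (1 - z * \<alpha> k)"
proof -
  assume "k \<le> 0"
  moreover from this have "{k..0} = insert k {k + 1..0}" by auto
  ultimately show ?thesis by (cases "k = 0") (simp_all add: shifted_power_alpha_def field_simps)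
qed

lemma shifted_power_beta_step_nonpos:
  "k \<le> 0 \<Longrightarrow> shifted_power_beta z \<beta> (k - 1) = shifted_power_beta z \<beta> k / (z - \<beta> k)"
proof -
  assume "k \<le> 0"
  moreover from this have "{k..0} = insert k {k + 1..0}" by auto
  ultimately show ?thesis by (cases "k = 0") (simp_all add: shifted_power_beta_def field_simps)
qed

lemma shifted_power_ratio_0 [simp]: "shifted_power_ratio \<alpha> \<beta> z w 0 = 1"
  by (simp add: shifted_power_ratio_def shifted_power_alpha_def shifted_power_beta_def)

lemma shifted_power_ratio_step_nonpos:
  assumes "k \<le> 0"
  shows "shifted_power_ratio \<alpha> \<beta> z w (k - 1) = shifted_power_ratio \<alpha> \<beta> z w k
    * (((1 - z * \<alpha> k) * (w - \<beta> k)) / ((z - \<beta> k) * (1 - w * \<alpha> k)))"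
  by (simp add: shifted_power_ratio_def shifted_power_alpha_step_nonpos [OF assms]
      shifted_power_beta_step_nonpos [OF assms] mult_ac)

lemma shifted_power_ratio_step_pos:
  assumes "0 < k"
  shows "shifted_power_ratio \<alpha> \<beta> z w k = shifted_power_ratio \<alpha> \<beta> z w (k - 1)
    * (((z - \<beta> k) * (1 - w * \<alpha> k)) / ((1 - z * \<alpha> k) * (w - \<beta> k)))"
  by (simp add: shifted_power_ratio_def shifted_power_alpha_step_pos [OF assms]
      shifted_power_beta_step_pos [OF assms] mult_ac)

lemma shifted_power_ratio_same_nonpos:
  assumes "\<forall>i\<le>0. z - \<beta> i \<noteq> 0 \<and> 1 - z * \<alpha> i \<noteq> 0" and "k \<le> 0"
  shows "shifted_power_ratio \<alpha> \<beta> z z k = 1"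
  using assms(2)
proof (induction k rule: int_le_induct)
  case (step i)
  then show ?case
    using assms(1) by (simp add: shifted_power_ratio_step_nonpos)
qed simp

lemma shifted_power_ratio_same_nonneg:
  assumes "\<forall>i>0. 1 - z * \<alpha> i \<noteq> 0 \<and> z - \<beta> i \<noteq> 0" and "0 \<le> k"
  shows "shifted_power_ratio \<alpha> \<beta> z z k = 1"
  using assms(2)
proof (induction k rule: int_ge_induct)
  case (step i)
  then show ?case
    using assms(1) by (simp add: shifted_power_ratio_step_pos)
qed simp

section \<open>Diagonal terms of the expansion\<close>

text \<open>
  With \<open>D = (z - \<beta>\<^sub>i) (1 - w \<alpha>\<^sub>i)\<close> and \<open>N = (1 - z \<alpha>\<^sub>i) (w - \<beta>\<^sub>i)\<close> the term is
  \<open>z (1 - \<alpha>\<^sub>i \<beta>\<^sub>i) R\<^sub>i / D\<close>, and \<open>D - N = (z - w) (1 - \<alpha>\<^sub>i \<beta>\<^sub>i)\<close> makes it a multiple of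
  \<open>R\<^sub>i (1 - N / D)\<close>, where \<open>R\<^sub>i N / D = R\<^sub>i\<^sub>-\<^sub>1\<close>.
\<close>

lemma diagonal_term_nonpos:
  assumes "i \<le> 0" "z \<noteq> w" "z - \<beta> i \<noteq> 0" "1 - w * \<alpha> i \<noteq> 0"
  shows "field_coeff \<alpha> \<beta> z i * dual_field_coeff \<alpha> \<beta> w i
    = z / (z - w) * (shifted_power_ratio \<alpha> \<beta> z w i - shifted_power_ratio \<alpha> \<beta> z w (i - 1))"
proof -
  let ?R = "shifted_power_ratio \<alpha> \<beta> z w i"
  let ?D = "(z - \<beta> i) * (1 - w * \<alpha> i)"
  let ?N = "(1 - z * \<alpha> i) * (w - \<beta> i)"
  have "?D - ?N = (z - w) * (1 - \<alpha> i * \<beta> i)"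
    by (simp add: algebra_simps)
  then have "z * (1 - \<alpha> i * \<beta> i) = z / (z - w) * (?D - ?N)"
    using assms(2) by simp
  moreover have "field_coeff \<alpha> \<beta> z i * dual_field_coeff \<alpha> \<beta> w i
      = z * (1 - \<alpha> i * \<beta> i) * (?R / ?D)"
    by (simp add: field_coeff_def dual_field_coeff_def shifted_power_ratio_def
        shifted_power_alpha_step_nonpos [OF assms(1)] shifted_power_beta_step_nonpos [OF assms(1)]
        mult_ac)
  ultimately have "field_coeff \<alpha> \<beta> z i * dual_field_coeff \<alpha> \<beta> w i
      = z / (z - w) * ((?D - ?N) * (?R / ?D))"
    by (simp only: mult.assoc)
  also have "(?D - ?N) * (?R / ?D) = ?R - ?R * (?N / ?D)"
  proof -
    have "(d - n) * (r / d) = r - r * (n / d)" if "d \<noteq> 0" for d n r :: complex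
      using that by (simp add: field_simps)
    then show ?thesis
      using assms(3,4) by simp
  qed
  finally show ?thesis
    by (simp only: shifted_power_ratio_step_nonpos [OF assms(1)])
qed

text \<open>
  For \<open>i > 0\<close> the roles of \<open>D\<close> and \<open>N\<close> are exchanged, which changes the sign, and the
  recursion runs upwards, so the term carries \<open>R\<^sub>i\<^sub>-\<^sub>1\<close> instead of \<open>R\<^sub>i\<close>.
\<close>

lemma diagonal_term_pos:
  assumes "0 < i" "z \<noteq> w" "1 - z * \<alpha> i \<noteq> 0" "w - \<beta> i \<noteq> 0"
  shows "dual_field_coeff \<alpha> \<beta> w i * field_coeff \<alpha> \<beta> z i
    = z / (w - z) * (shifted_power_ratio \<alpha> \<beta> z w (i - 1) - shifted_power_ratio \<alpha> \<beta> z w i)"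
proof -
  let ?R = "shifted_power_ratio \<alpha> \<beta> z w (i - 1)"
  let ?D = "(1 - z * \<alpha> i) * (w - \<beta> i)"
  let ?N = "(z - \<beta> i) * (1 - w * \<alpha> i)"
  have "?D - ?N = (w - z) * (1 - \<alpha> i * \<beta> i)"
    by (simp add: algebra_simps)
  then have "z * (1 - \<alpha> i * \<beta> i) = z / (w - z) * (?D - ?N)"
    using assms(2) by simp
  moreover have "dual_field_coeff \<alpha> \<beta> w i * field_coeff \<alpha> \<beta> z i
      = z * (1 - \<alpha> i * \<beta> i) * (?R / ?D)"
    by (simp add: field_coeff_def dual_field_coeff_def shifted_power_ratio_def
        shifted_power_alpha_step_pos [OF assms(1)] shifted_power_beta_step_pos [OF assms(1)]
        mult_ac)
  ultimately have "dual_field_coeff \<alpha> \<beta> w i * field_coeff \<alpha> \<beta> z i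
      = z / (w - z) * ((?D - ?N) * (?R / ?D))"
    by (simp only: mult.assoc)
  also have "(?D - ?N) * (?R / ?D) = ?R - ?R * (?N / ?D)"
  proof -
    have "(d - n) * (r / d) = r - r * (n / d)" if "d \<noteq> 0" for d n r :: complex
      using that by (simp add: field_simps)
    then show ?thesis
      using assms(3,4) by simp
  qed
  finally show ?thesis
    by (simp only: shifted_power_ratio_step_pos [OF assms(1)])
qed

section \<open>Vacuum expectations of two fields\<close>

context fermionic_fock_space
begin

lemma psi_0: "psi i 0 = 0"
  using linear_psi by (rule module_hom.zero [OF Vector_Spaces.linear.axioms(3)])

lemma psis_0: "psis i 0 = 0"
  using linear_psis by (rule module_hom.zero [OF Vector_Spaces.linear.axioms(3)])

lemma covac_0: "covac 0 = 0"
  using linear_covac by (rule module_hom.zero [OF Vector_Spaces.linear.axioms(3)])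

lemma covac_psi_psis_vac:
  "covac (psi i (psis j vac)) = (if i = j \<and> i \<le> 0 then 1 else 0)"
proof (cases "i \<le> 0 \<and> j \<le> 0")
  case True
  then have "psi i (psis j vac) = (if i = j then vac else 0)"
    using psi_psis [of i j vac] by (simp add: psi_vac psis_0)
  with True show ?thesis
    by (simp add: covac_vac covac_0)
next
  case False
  then show ?thesis
    by (auto simp: covac_psi psis_vac psi_0 covac_0 not_le)
qed

lemma covac_psis_psi_vac:
  "covac (psis j (psi i vac)) = (if j = i \<and> 0 < j then 1 else 0)"
proof (cases "0 < i \<and> 0 < j")
  case True
  then have "psis j (psi i vac) = (if i = j then vac else 0)"
    using psi_psis [of i j vac] by (simp add: psis_vac psi_0)
  with True show ?thesis
    by (auto simp: covac_vac covac_0)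
next
  case False
  then show ?thesis
    by (auto simp: covac_psis psi_vac psis_0 covac_0 not_less)
qed

theorem vacuum_expectation_psi_psis:
  assumes nz: "\<forall>i\<le>0. z - \<beta> i \<noteq> 0 \<and> 1 - w * \<alpha> i \<noteq> 0"
    and lim: "(\<lambda>n::nat. shifted_power_ratio \<alpha> \<beta> z w (- (int n + 1))) \<longlonglongrightarrow> 0"
  shows "vacuum_expectation_sums covac vac
    (field_coeff \<alpha> \<beta> z) psi (dual_field_coeff \<alpha> \<beta> w) psis (z / (z - w))"
proof -
  let ?R = "shifted_power_ratio \<alpha> \<beta> z w"
  have "z \<noteq> w"
  proof
    assume "z = w"
    with nz have "?R (- (int n + 1)) = 1" for n
      by (auto intro: shifted_power_ratio_same_nonpos)
    with lim have "(\<lambda>n::nat. 1::complex) \<longlonglongrightarrow> 0" by simp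
    then show False by (simp add: LIMSEQ_const_iff)
  qed
  define F where "F i = z / (z - w) * ?R (min i 0)" for i
  have "double_series_sums (\<lambda>i j. field_coeff \<alpha> \<beta> z i * dual_field_coeff \<alpha> \<beta> w j
      * covac (psi i (psis j vac))) (z / (z - w) - z / (z - w) * 0)"
  proof (rule double_series_sums_telescoping)
    fix i j
    show "field_coeff \<alpha> \<beta> z i * dual_field_coeff \<alpha> \<beta> w j * covac (psi i (psis j vac))
        = (if i = j then F i - F (i - 1) else 0)"
    proof (cases "i \<le> 0")
      case True
      then have "F i - F (i - 1) = z / (z - w) * (?R i - ?R (i - 1))"
        by (simp add: F_def right_diff_distrib)
      with True nz \<open>z \<noteq> w\<close> show ?thesis
        by (auto simp: covac_psi_psis_vac diagonal_term_nonpos)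
    next
      case False
      then have "min i 0 = 0" "min (i - 1) 0 = 0"
        by auto
      with False show ?thesis
        by (simp add: covac_psi_psis_vac F_def)
    qed
  next
    have "\<forall>\<^sub>F i in at_top. z / (z - w) = F i"
      using eventually_ge_at_top [of 0] by eventually_elim (simp add: F_def min_def)
    then show "(F \<longlongrightarrow> z / (z - w)) at_top"
      by (rule Lim_transform_eventually [OF tendsto_const])
  next
    have "((\<lambda>i. z / (z - w) * ?R i) \<longlongrightarrow> z / (z - w) * 0) at_bot"
      by (intro tendsto_mult_left tendsto_int_at_bot_from_nat lim)
    moreover have "\<forall>\<^sub>F i in at_bot. z / (z - w) * ?R i = F i"
      using eventually_le_at_bot [of 0] by eventually_elim (simp add: F_def)
    ultimately show "(F \<longlongrightarrow> z / (z - w) * 0) at_bot"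
      by (rule Lim_transform_eventually)
  qed
  then show ?thesis
    by (simp add: vacuum_expectation_sums_def)
qed

theorem vacuum_expectation_psis_psi:
  assumes nz: "\<forall>i>0. 1 - z * \<alpha> i \<noteq> 0 \<and> w - \<beta> i \<noteq> 0"
    and lim: "(\<lambda>n::nat. shifted_power_ratio \<alpha> \<beta> z w (int n + 1)) \<longlonglongrightarrow> 0"
  shows "vacuum_expectation_sums covac vac
    (dual_field_coeff \<alpha> \<beta> w) psis (field_coeff \<alpha> \<beta> z) psi (z / (w - z))"
proof -
  let ?R = "shifted_power_ratio \<alpha> \<beta> z w"
  have "z \<noteq> w"
  proof
    assume "z = w"
    with nz have "?R (int n + 1) = 1" for n
      by (auto intro: shifted_power_ratio_same_nonneg)
    with lim have "(\<lambda>n::nat. 1::complex) \<longlonglongrightarrow> 0" by simp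
    then show False by (simp add: LIMSEQ_const_iff)
  qed
  define F where "F i = - (z / (w - z)) * ?R (max i 0)" for i
  have "double_series_sums (\<lambda>j i. dual_field_coeff \<alpha> \<beta> w j * field_coeff \<alpha> \<beta> z i
      * covac (psis j (psi i vac))) (- (z / (w - z)) * 0 - - (z / (w - z)))"
  proof (rule double_series_sums_telescoping)
    fix j i
    show "dual_field_coeff \<alpha> \<beta> w j * field_coeff \<alpha> \<beta> z i * covac (psis j (psi i vac))
        = (if j = i then F j - F (j - 1) else 0)"
    proof (cases "0 < j")
      case True
      then have "F j - F (j - 1) = z / (w - z) * (?R (j - 1) - ?R j)"
        by (simp add: F_def right_diff_distrib)
      with True nz \<open>z \<noteq> w\<close> show ?thesis
        by (auto simp: covac_psis_psi_vac diagonal_term_pos)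
    next
      case False
      then have "max j 0 = 0" "max (j - 1) 0 = 0"
        by auto
      with False show ?thesis
        by (simp add: covac_psis_psi_vac F_def)
    qed
  next
    have "((\<lambda>i. - (z / (w - z)) * ?R i) \<longlongrightarrow> - (z / (w - z)) * 0) at_top"
      by (intro tendsto_mult_left tendsto_int_at_top_from_nat lim)
    moreover have "\<forall>\<^sub>F i in at_top. - (z / (w - z)) * ?R i = F i"
      using eventually_ge_at_top [of 0] by eventually_elim (simp add: F_def)
    ultimately show "(F \<longlongrightarrow> - (z / (w - z)) * 0) at_top"
      by (rule Lim_transform_eventually)
  next
    have "\<forall>\<^sub>F i in at_bot. - (z / (w - z)) = F i"
      using eventually_le_at_bot [of 0] by eventually_elim (simp add: F_def max_def)
    then show "(F \<longlongrightarrow> - (z / (w - z))) at_bot"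
      by (rule Lim_transform_eventually [OF tendsto_const])
  qed
  then show ?thesis
    by (simp add: vacuum_expectation_sums_def)
qed

end

theorem proposition4p1:
  fixes \<alpha> \<beta> :: "int \<Rightarrow> complex"
    and z w :: complex
    and scale :: "complex \<Rightarrow> 'v::ab_group_add \<Rightarrow> 'v"
    and psi psis :: "int \<Rightarrow> 'v \<Rightarrow> 'v"
    and vac :: 'v
    and covac :: "'v \<Rightarrow> complex"
  assumes "fermionic_fock_space scale psi psis vac covac"
  shows "((\<forall>i\<le>0. z - \<beta> i \<noteq> 0 \<and> 1 - w * \<alpha> i \<noteq> 0) \<longrightarrow>
      ((\<lambda>n::nat. shifted_power_ratio \<alpha> \<beta> z w (- (int n + 1))) \<longlonglongrightarrow> 0) \<longrightarrow>
      vacuum_expectation_sums covac vac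
        (field_coeff \<alpha> \<beta> z) psi (dual_field_coeff \<alpha> \<beta> w) psis (z / (z - w)))
    \<and> ((\<forall>i>0. 1 - z * \<alpha> i \<noteq> 0 \<and> w - \<beta> i \<noteq> 0) \<longrightarrow>
      ((\<lambda>n::nat. shifted_power_ratio \<alpha> \<beta> z w (int n + 1)) \<longlonglongrightarrow> 0) \<longrightarrow>
      vacuum_expectation_sums covac vac
        (dual_field_coeff \<alpha> \<beta> w) psis (field_coeff \<alpha> \<beta> z) psi (z / (w - z)))"
proof -
  interpret fermionic_fock_space scale psi psis vac covac
    by (rule assms)
  show ?thesis
    using vacuum_expectation_psi_psis vacuum_expectation_psis_psi by blast
qed

end
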